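(* Let $n\ge 1$, let $A(z)\in\mathcal H(S^1)^{n\times n}$ be a para-Hermitian matrix, and let $\mu_1(z),\dots,\mu_n(z)\in\mathcal H(S^1)$ be functions such that, for every $z_0\in S^1$, the eigenvalues of $A(z_0)$ (counted with multiplicity) are precisely $(\mu_1(z_0),\dots,\mu_n(z_0))\in\mathbb R^n$. Then there exists a para-unitary matrix $U(z)\in\mathcal H(S^1)^{n\times n}$ such that $A(z)=U(z)D(z)U(z)^P$, where $D(z)\in\mathcal H(S^1)^{n\times n}$ is diagonal and its $(i,i)$ element is equal to $\mu_i(z)$ for $i=1,\dots,n$.
   Context: $S^1=\{z\in\mathbb C:|z|=1\}$. $\mathcal H(S^1)$ is the ring of functions holomorphic on $S^1$, i.e. functions on $S^1$ that admit a holomorphic extension to some open neighbourhood of $S^1$ (equivalently, Laurent series $\sum_{k\in\mathbb Z}a_kz^k$ converging in an open annulus containing $S^1$). For $A(z)=[a_{i,j}(z)]\in\mathcal H(S^1)^{m\times n}$, the para-Hermitian conjugate $A(z)^P\in\mathcal H(S^1)^{n\times m}$ is the matrix whose $(i,j)$ entry is $\overline{a_{j,i}(\overline z^{-1})}$; on $S^1$ it coincides with the conjugate transpose $A(z)^*$. A square matrix $A(z)\in\mathcal H(S^1)^{n\times n}$ is para-Hermitian if $A(z)=A(z)^P$, and $U(z)\in\mathcal H(S^1)^{n\times n}$ is para-unitary if $U(z)U(z)^P=U(z)^PU(z)=I$. *)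

theory Defs
  imports
    "HOL-Analysis.Complex_Analysis_Basics"
    "Jordan_Normal_Form.Char_Poly"
begin

abbreviation unit_circle :: "complex set" where
  "unit_circle \<equiv> sphere 0 1"

text \<open>
  A function on the unit circle is represented by a total function on the complex numbers of which
  only the values on the circle are relevant; accordingly, identities between such functions
  are always stated pointwise on the circle. By the identity theorem this agrees with equality of
  the holomorphic extensions near the circle.
\<close>

definition hol_circle :: "(complex \<Rightarrow> complex) set" where
  "hol_circle = {f. \<exists>T g. open T \<and> unit_circle \<subseteq> T \<and> g holomorphic_on T \<and>
                          (\<forall>z\<in>unit_circle. g z = f z)}"

definition hol_circle_mat :: "nat \<Rightarrow> nat \<Rightarrow> (complex \<Rightarrow> complex mat) set" where
  "hol_circle_mat m n = {A. (\<forall>z\<in>unit_circle. A z \<in> carrier_mat m n) \<and>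
                            (\<forall>i<m. \<forall>j<n. (\<lambda>z. A z $$ (i, j)) \<in> hol_circle)}"

text \<open>
  The point at which \<open>A\<close> is evaluated is left as in the formula for the holomorphic extension;
  for \<open>z\<close> on the circle it is again \<open>z\<close>, see \<open>inverse_cnj_unit_circle\<close> below.
\<close>

definition para_conj :: "(complex \<Rightarrow> complex mat) \<Rightarrow> complex \<Rightarrow> complex mat" where
  "para_conj A z =
     (let B = A (inverse (cnj z))
      in Matrix.mat (dim_col B) (dim_row B) (\<lambda>(i, j). cnj (B $$ (j, i))))"

definition para_hermitian :: "nat \<Rightarrow> (complex \<Rightarrow> complex mat) \<Rightarrow> bool" where
  "para_hermitian n A \<longleftrightarrow>
     A \<in> hol_circle_mat n n \<and> (\<forall>z\<in>unit_circle. A z = para_conj A z)"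

definition para_unitary :: "nat \<Rightarrow> (complex \<Rightarrow> complex mat) \<Rightarrow> bool" where
  "para_unitary n U \<longleftrightarrow>
     U \<in> hol_circle_mat n n \<and>
     (\<forall>z\<in>unit_circle. U z * para_conj U z = 1\<^sub>m n \<and> para_conj U z * U z = 1\<^sub>m n)"

text \<open>The eigenvalues of a square matrix, counted with algebraic multiplicity.\<close>

definition eigenvalues_mset :: "complex mat \<Rightarrow> complex multiset" where
  "eigenvalues_mset A = proots (char_poly A)"

lemma char_poly_nonzero:
  assumes "A \<in> carrier_mat n n"
  shows "char_poly A \<noteq> (0 :: complex poly)"
  using degree_monic_char_poly[OF assms] by auto

lemma set_eigenvalues_mset:
  assumes "A \<in> carrier_mat n n"
  shows "set_mset (eigenvalues_mset A) = {k. eigenvalue A k}"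
  using char_poly_nonzero[OF assms] eigenvalue_root_char_poly[OF assms]
  by (auto simp: eigenvalues_mset_def)

lemma count_eigenvalues_mset:
  assumes "A \<in> carrier_mat n n"
  shows "count (eigenvalues_mset A) k = order k (char_poly A)"
  using char_poly_nonzero[OF assms] by (simp add: eigenvalues_mset_def)

lemma inverse_cnj_unit_circle:
  assumes "z \<in> unit_circle"
  shows "inverse (cnj z) = z"
proof -
  have "z * cnj z = 1"
    using assms by (simp add: complex_norm_square [symmetric])
  then show ?thesis
    by (metis inverse_unique mult.commute)
qed

lemma hol_circle_iff_analytic:
  "f \<in> hol_circle \<longleftrightarrow> (\<exists>g. g analytic_on unit_circle \<and> (\<forall>z\<in>unit_circle. g z = f z))"
  unfolding hol_circle_def mem_Collect_eq analytic_on_holomorphic by blast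

lemma para_conj_unit_circle:
  assumes "A \<in> hol_circle_mat m n" "z \<in> unit_circle"
  shows "para_conj A z = Matrix.mat n m (\<lambda>(i, j). cnj (A z $$ (j, i)))"
proof -
  have "A z \<in> carrier_mat m n"
    using assms by (auto simp: hol_circle_mat_def)
  then show ?thesis
    using inverse_cnj_unit_circle[OF assms(2)] by (simp add: para_conj_def)
qed

lemma hol_circle_conj:
  assumes "f \<in> hol_circle"
  shows "(\<lambda>z. cnj (f (inverse (cnj z)))) \<in> hol_circle"
proof -
  obtain T g where g: "open T" "unit_circle \<subseteq> T" "g holomorphic_on T"
      "\<forall>z\<in>unit_circle. g z = f z"
    using assms by (auto simp: hol_circle_def)
  have "open (cnj ` T)"
  proof -
    have "cnj ` T = cnj -` T"
      by (auto simp: image_iff) (metis complex_cnj_cnj)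
    moreover have "open (cnj -` T)"
      using g(1) by (intro open_vimage continuous_intros) auto
    ultimately show ?thesis by simp
  qed
  moreover have "cnj ` cnj ` T = T"
    by (simp add: image_image)
  ultimately have "(cnj \<circ> g \<circ> cnj) holomorphic_on cnj ` T"
    using g(3) by (intro holomorphic_on_compose_cnj_cnj) simp_all
  moreover have "unit_circle \<subseteq> cnj ` T"
  proof
    fix z :: complex assume "z \<in> unit_circle"
    then have "cnj z \<in> T" using g(2) by auto
    then show "z \<in> cnj ` T" by (metis complex_cnj_cnj imageI)
  qed
  ultimately have "(cnj \<circ> g \<circ> cnj) analytic_on unit_circle"
    using \<open>open (cnj ` T)\<close> analytic_on_holomorphic by blast
  moreover have "inverse analytic_on unit_circle"
    by (intro analytic_intros) auto
  moreover have im: "inverse ` unit_circle \<subseteq> unit_circle"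
    by (auto simp: norm_inverse)
  ultimately have "((cnj \<circ> g \<circ> cnj) \<circ> inverse) analytic_on unit_circle"
    by (metis analytic_on_compose analytic_on_subset)
  moreover have "((cnj \<circ> g \<circ> cnj) \<circ> inverse) z = cnj (f (inverse (cnj z)))"
    if "z \<in> unit_circle" for z
    using g(4) that by (simp add: norm_inverse)
  ultimately show ?thesis
    unfolding hol_circle_iff_analytic by blast
qed

lemma para_conj_hol_circle_mat:
  assumes "A \<in> hol_circle_mat m n"
  shows "para_conj A \<in> hol_circle_mat n m"
proof -
  have carrier: "para_conj A z \<in> carrier_mat n m" if "z \<in> unit_circle" for z
    using para_conj_unit_circle[OF assms that] by simp
  have "(\<lambda>z. para_conj A z $$ (i, j)) \<in> hol_circle" if ij: "i < n" "j < m" for i j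
  proof -
    have "(\<lambda>z. A z $$ (j, i)) \<in> hol_circle"
      using assms ij by (auto simp: hol_circle_mat_def)
    from hol_circle_conj[OF this] obtain g where
      g: "g analytic_on unit_circle"
        "\<forall>z\<in>unit_circle. g z = cnj (A (inverse (cnj z)) $$ (j, i))"
      by (auto simp: hol_circle_iff_analytic)
    moreover have "para_conj A z $$ (i, j) = cnj (A (inverse (cnj z)) $$ (j, i))"
      if "z \<in> unit_circle" for z
      using para_conj_unit_circle[OF assms that] ij inverse_cnj_unit_circle[OF that] by simp
    ultimately show ?thesis
      unfolding hol_circle_iff_analytic by (intro exI[of _ g]) auto
  qed
  with carrier show ?thesis
    by (simp add: hol_circle_mat_def)
qed

end

theory Submission
  imports Defs "HOL-Complex_Analysis.Conformal_Mappings" "Jordan_Normal_Form.Schur_Decomposition"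
begin

text \<open>
  The columns of the unitary matrix are found one after the other, each as an eigenvector
  orthogonal to its predecessors. Suppose that orthonormal eigenvectors
  \<open>u\<^sub>0, \<dots>, u\<^sub>k\<^sub>-\<^sub>1\<close> for \<open>\<mu>\<^sub>0, \<dots>, \<mu>\<^sub>k\<^sub>-\<^sub>1\<close>, all holomorphic on the circle, are known.
  The next column \<open>v\<close> has to solve the homogeneous linear system \<open>(A - \<mu>\<^sub>k) v = 0\<close>,
  \<open>u\<^sub>j\<^sup>* v = 0\<close> for \<open>j < k\<close>. On the circle conjugation preserves holomorphy, since there
  \<open>cnj z\<close> equals \<open>1 / z\<close>; so the coefficients of this system belong to the ring
  of functions holomorphic on the circle.

  At a single point the system is solvable by linear algebra. If \<open>\<mu>\<^sub>k(z)\<close> has multiplicity \<open>m\<close>,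
  the eigenspace of the Hermitian matrix \<open>A(z)\<close> has dimension \<open>m\<close>. At most \<open>m - 1\<close> of the
  \<open>u\<^sub>j(z)\<close> belong to the same eigenvalue, so some nonzero eigenvector is orthogonal to them, and
  it is orthogonal to the others automatically
  (\<open>hermitian_orthogonal_eigenvector\<close>). Such a pointwise choice need not
  be continuous in \<open>z\<close>, all the more as the multiplicity may jump.

  The passage from points to functions is algebraic. A function holomorphic on the circle and not
  identically zero there has only finitely many zeros on it, so the ring has no
  zero divisors, and fraction-free Gaussian elimination turns pointwise solvability into a
  solution over the ring that is not identically zero (\<open>hol_circle_kernel_vector\<close>). It may vanish
  at finitely many points of the circle; dividing by suitable powers of \<open>z - z\<^sub>0\<close> removes these
  zeros (\<open>divide_common_zeros\<close>). This is the step which carries the eigenvectors holomorphically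
  through points where eigenvalues cross. A solution \<open>w\<close> without zeros is normalized:
  \<open>w\<^sup>* w\<close> is holomorphic on the circle and positive there, so its principal square root is holomorphic
  as well (\<open>hol_circle_unit_kernel_vector\<close>).
\<close>

section \<open>Eigenvectors of a Hermitian matrix at one point\<close>

lemma hermitian_sum_adjoint:
  fixes b :: "nat \<Rightarrow> nat \<Rightarrow> complex"
  assumes "\<And>r s. r < n \<Longrightarrow> s < n \<Longrightarrow> b r s = cnj (b s r)"
  shows "(\<Sum>r<n. cnj (y r) * (\<Sum>s<n. b r s * x s)) = (\<Sum>s<n. cnj (\<Sum>r<n. b s r * y r) * x s)"
proof -
  have "(\<Sum>r<n. cnj (y r) * (\<Sum>s<n. b r s * x s)) = (\<Sum>r<n. \<Sum>s<n. cnj (b s r * y r) * x s)"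
    unfolding sum_distrib_left
  proof (intro sum.cong refl)
    fix r s assume "r \<in> {..<n}" "s \<in> {..<n}"
    then show "cnj (y r) * (b r s * x s) = cnj (b s r * y r) * x s"
      using assms[of r s] by simp
  qed
  also have "\<dots> = (\<Sum>s<n. \<Sum>r<n. cnj (b s r * y r) * x s)"
    by (rule sum.swap)
  finally show ?thesis by (simp add: sum_distrib_right)
qed

lemma sum_cnj_mult_self:
  fixes y :: "nat \<Rightarrow> complex"
  shows "(\<Sum>r<n. cnj (y r) * y r) = of_real (\<Sum>r<n. (cmod (y r))\<^sup>2)"
  unfolding of_real_sum by (intro sum.cong refl) (metis complex_norm_square mult.commute)

lemma sum_cnj_mult_self_eq_0:
  fixes y :: "nat \<Rightarrow> complex"
  assumes "(\<Sum>r<n. cnj (y r) * y r) = 0" "r < n"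
  shows "y r = 0"
proof -
  have "(\<Sum>r<n. (cmod (y r))\<^sup>2) = 0"
    using assms(1) unfolding sum_cnj_mult_self of_real_eq_0_iff .
  then show ?thesis using assms(2) by (simp add: sum_nonneg_eq_0_iff)
qed

text \<open>For Hermitian \<open>b\<close> the kernels of \<open>b - l\<close> and \<open>(b - l)\<^sup>2\<close> coincide: if \<open>y = (b - l) x\<close>
  is annihilated by \<open>b - l\<close>, then \<open>y\<^sup>* y = y\<^sup>* (b - l) x = ((b - l) y)\<^sup>* x = 0\<close>. This is what turns
  algebraic into geometric multiplicity below.\<close>

lemma hermitian_generalized_eigenvector:
  fixes b :: "nat \<Rightarrow> nat \<Rightarrow> complex"
  assumes herm: "\<And>r s. r < n \<Longrightarrow> s < n \<Longrightarrow> b r s = cnj (b s r)" and "l \<in> \<real>"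
    and y: "\<And>r. r < n \<Longrightarrow> (\<Sum>s<n. b r s * x s) - l * x r = y r"
    and eig_y: "\<And>r. r < n \<Longrightarrow> (\<Sum>s<n. b r s * y s) = l * y r"
    and "r < n"
  shows "y r = 0"
proof -
  have "(\<Sum>r<n. cnj (y r) * y r) = (\<Sum>r<n. cnj (y r) * ((\<Sum>s<n. b r s * x s) - l * x r))"
    using y by simp
  also have "\<dots> = (\<Sum>r<n. cnj (y r) * (\<Sum>s<n. b r s * x s)) - (\<Sum>r<n. cnj (y r) * (l * x r))"
    by (simp add: right_diff_distrib sum_subtractf)
  also have "\<dots> = (\<Sum>r<n. cnj (l * y r) * x r) - (\<Sum>r<n. cnj (y r) * (l * x r))"
    using hermitian_sum_adjoint[of n b y x, OF herm] eig_y by simp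
  also have "\<dots> = 0"
    using \<open>l \<in> \<real>\<close> by (auto simp: Reals_cnj_iff mult_ac)
  finally show ?thesis using sum_cnj_mult_self_eq_0 \<open>r < n\<close> by blast
qed

lemma hermitian_eigenvectors_orthogonal:
  fixes b :: "nat \<Rightarrow> nat \<Rightarrow> complex"
  assumes herm: "\<And>r s. r < n \<Longrightarrow> s < n \<Longrightarrow> b r s = cnj (b s r)"
    and "l \<in> \<real>" "l \<noteq> l'"
    and y: "\<And>r. r < n \<Longrightarrow> (\<Sum>s<n. b r s * y s) = l * y r"
    and x: "\<And>r. r < n \<Longrightarrow> (\<Sum>s<n. b r s * x s) = l' * x r"
  shows "(\<Sum>r<n. cnj (y r) * x r) = 0"
proof -
  have "l' * (\<Sum>r<n. cnj (y r) * x r) = (\<Sum>r<n. cnj (y r) * (\<Sum>s<n. b r s * x s))"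
    unfolding sum_distrib_left[of l'] using x by (intro sum.cong) auto
  also have "\<dots> = (\<Sum>r<n. cnj (l * y r) * x r)"
    using hermitian_sum_adjoint[of n b y x, OF herm] y by simp
  also have "\<dots> = l * (\<Sum>r<n. cnj (y r) * x r)"
    unfolding sum_distrib_left using \<open>l \<in> \<real>\<close> by (intro sum.cong) (auto simp: Reals_cnj_iff)
  finally show ?thesis using \<open>l \<noteq> l'\<close> by simp
qed

lemma char_poly_eq_prod_list:
  assumes "B \<in> carrier_mat n n" "mset es = eigenvalues_mset B"
  shows "char_poly B = (\<Prod>e\<leftarrow>es. [:- e, 1:])"
proof -
  have "char_poly B = (\<Prod>x\<in>#proots (char_poly B). [:- x, 1:])"
    using complex_poly_decompose_multiset[of "char_poly B"] degree_monic_char_poly[OF assms(1)]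
    by simp
  also have "\<dots> = (\<Prod>e\<leftarrow>es. [:- e, 1:])"
    unfolding eigenvalues_mset_def[symmetric] assms(2)[symmetric]
    by (simp add: prod_mset_prod_list flip: mset_map)
  finally show ?thesis .
qed

text \<open>Triangularize \<open>B\<close> with the \<open>m\<close> copies of \<open>l\<close> in front on the diagonal. By
  triangularity \<open>B - l\<close> maps each of the first \<open>m\<close> basis vectors into the span of the preceding
  ones. By induction these are eigenvectors, so the vector itself is
  annihilated by \<open>(B - l)\<^sup>2\<close> and hence an eigenvector.
  Linear independence is expressed by the left inverse \<open>Q\<close>.\<close>

lemma hermitian_independent_eigenvectors:
  assumes B: "B \<in> carrier_mat n n"
    and herm: "\<And>r s. r < n \<Longrightarrow> s < n \<Longrightarrow> B $$ (r, s) = cnj (B $$ (s, r))"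
    and l: "l \<in> \<real>" and m: "m = count (eigenvalues_mset B) l"
  shows "\<exists>P Q. P \<in> carrier_mat n n \<and> Q \<in> carrier_mat n n \<and> Q * P = 1\<^sub>m n \<and> m \<le> n \<and>
           (\<forall>i<m. \<forall>r<n. (\<Sum>s<n. B $$ (r, s) * P $$ (s, i)) = l * P $$ (r, i))"
proof -
  obtain xs where xs: "mset xs = filter_mset (\<lambda>x. x \<noteq> l) (eigenvalues_mset B)"
    using ex_mset by blast
  define es where "es = replicate m l @ xs"
  have "mset es = filter_mset (\<lambda>x. x = l) (eigenvalues_mset B) + filter_mset (\<lambda>x. x \<noteq> l) (eigenvalues_mset B)"
    by (simp add: es_def xs m filter_eq_replicate_mset)
  then have "mset es = eigenvalues_mset B"
    using multiset_partition[of "eigenvalues_mset B" "\<lambda>x. x = l"] by simp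
  then have c: "char_poly B = (\<Prod>e\<leftarrow>es. [:- e, 1:])"
    by (rule char_poly_eq_prod_list[OF B])
  obtain T P Q where TPQ: "schur_decomposition B es = (T, P, Q)"
    by (cases "schur_decomposition B es") auto
  from schur_decomposition[OF B c TPQ]
  have sim: "similar_mat_wit B T P Q" and up: "upper_triangular T" and diag: "diag_mat T = es"
    by auto
  from similar_mat_witD2[OF B sim]
  have PQ: "Q * P = 1\<^sub>m n" "P * Q = 1\<^sub>m n" "B = P * T * Q" and T: "T \<in> carrier_mat n n"
    and P: "P \<in> carrier_mat n n" and Q: "Q \<in> carrier_mat n n" by auto
  have "length es = n" using diag T by (auto simp: diag_mat_def)
  then have "m \<le> n" by (simp add: es_def)
  have T_diag: "T $$ (i, i) = l" if "i < m" for i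
  proof -
    have "T $$ (i, i) = es ! i"
      using that \<open>m \<le> n\<close> T diag by (auto simp: diag_mat_def)
    then show ?thesis using that by (simp add: es_def nth_append)
  qed
  have BP_PT: "B * P = P * T"
    using PQ P Q T B by (simp add: assoc_mult_mat[of _ n n _ n _ n])
  have BP: "(\<Sum>s<n. B $$ (r, s) * P $$ (s, i)) = (\<Sum>s<n. P $$ (r, s) * T $$ (s, i))"
    if "r < n" "i < n" for r i
  proof -
    have "(\<Sum>s<n. B $$ (r, s) * P $$ (s, i)) = (B * P) $$ (r, i)"
      using that B P by (simp add: scalar_prod_def atLeast0LessThan)
    also have "\<dots> = (\<Sum>s<n. P $$ (r, s) * T $$ (s, i))"
      unfolding BP_PT using that P T by (simp add: scalar_prod_def atLeast0LessThan)
    finally show ?thesis .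
  qed
  have "\<forall>r<n. (\<Sum>s<n. B $$ (r, s) * P $$ (s, i)) = l * P $$ (r, i)" if "i < m" for i
    using that
  proof (induction i rule: less_induct)
    case (less i)
    have "i < n" using less.prems \<open>m \<le> n\<close> by simp
    define y where "y = (\<lambda>r. \<Sum>j<i. P $$ (r, j) * T $$ (j, i))"
    have "(\<Sum>s<n. B $$ (r, s) * P $$ (s, i)) = y r + l * P $$ (r, i)" if "r < n" for r
    proof -
      have "(\<Sum>s<n. P $$ (r, s) * T $$ (s, i)) = (\<Sum>s<Suc i. P $$ (r, s) * T $$ (s, i))"
        using \<open>i < n\<close> up T by (intro sum.mono_neutral_right) (auto simp: upper_triangular_def)
      then show ?thesis
        using BP[OF that \<open>i < n\<close>] T_diag[OF less.prems] by (simp add: y_def mult.commute)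
    qed
    moreover have "y r = 0" if "r < n" for r
    proof (rule hermitian_generalized_eigenvector[of n "\<lambda>r s. B $$ (r, s)" l "\<lambda>s. P $$ (s, i)", OF herm])
      fix r assume "r < n"
      have "(\<Sum>s<n. B $$ (r, s) * y s) = (\<Sum>j<i. (\<Sum>s<n. B $$ (r, s) * P $$ (s, j)) * T $$ (j, i))"
        unfolding y_def sum_distrib_left sum_distrib_right mult.assoc by (rule sum.swap)
      also have "\<dots> = (\<Sum>j<i. l * P $$ (r, j) * T $$ (j, i))"
        using less.IH less.prems \<open>r < n\<close> by (intro sum.cong) auto
      also have "\<dots> = l * y r"
        by (simp add: y_def sum_distrib_left mult.assoc)
      finally show "(\<Sum>s<n. B $$ (r, s) * y s) = l * y r" .
    qed (use l that calculation in auto)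
    ultimately show ?case by simp
  qed
  with P Q PQ(1) \<open>m \<le> n\<close> show ?thesis by blast
qed

lemma homogeneous_system_zero_row:
  fixes R :: "nat \<Rightarrow> nat \<Rightarrow> complex"
  assumes "r0 < m" "\<And>i. i < m \<Longrightarrow> R r0 i = 0"
  shows "\<exists>x. (\<exists>i<m. x i \<noteq> 0) \<and> (\<forall>r<m. (\<Sum>i<m. R r i * x i) = 0)"
proof -
  define M where "M = Matrix.mat m m (\<lambda>(r, i). R r i)"
  have M: "M \<in> carrier_mat m m" by (simp add: M_def)
  have "Determinant.det M = 0"
    unfolding det_def'[OF M]
  proof (intro sum.neutral ballI)
    fix p assume "p \<in> {p. p permutes {0..<m}}"
    then have "p r0 < m" using assms(1) by (auto dest: permutes_in_image[of _ _ r0])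
    then have "\<exists>i\<in>{0..<m}. M $$ (i, p i) = 0"
      using assms by (intro bexI[of _ r0]) (auto simp: M_def)
    then show "signof p * (\<Prod>i = 0..<m. M $$ (i, p i)) = 0"
      by (simp add: prod_zero)
  qed
  then obtain v where v: "v \<in> carrier_vec m" "v \<noteq> 0\<^sub>v m" "M *\<^sub>v v = 0\<^sub>v m"
    using det_0_iff_vec_prod_zero[OF M] by blast
  have "\<exists>i<m. v $ i \<noteq> 0"
    using v(1,2) by (auto intro!: eq_vecI)
  moreover have "(\<Sum>i<m. R r i * v $ i) = 0" if "r < m" for r
  proof -
    have "(M *\<^sub>v v) $ r = 0" using v(3) that by simp
    then show ?thesis
      using that v(1) by (simp add: M_def scalar_prod_def atLeast0LessThan)
  qed
  ultimately show ?thesis by blast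
qed

text \<open>Only the \<open>u j\<close> with the same eigenvalue \<open>l k\<close> impose conditions on an eigenvector for
  \<open>l k\<close>. As \<open>k\<close> itself is among the indices with this eigenvalue, they are fewer than the
  multiplicity, so a linear combination of \<open>hermitian_independent_eigenvectors\<close> satisfies them.\<close>

lemma hermitian_orthogonal_eigenvector:
  assumes B: "B \<in> carrier_mat n n"
    and herm: "\<And>r s. r < n \<Longrightarrow> s < n \<Longrightarrow> B $$ (r, s) = cnj (B $$ (s, r))"
    and eig: "eigenvalues_mset B = image_mset l (mset_set {..<n})"
    and real: "\<And>j. j < n \<Longrightarrow> l j \<in> \<real>"
    and k: "k < n"
    and u: "\<And>j r. j < k \<Longrightarrow> r < n \<Longrightarrow> (\<Sum>s<n. B $$ (r, s) * u j s) = l j * u j r"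
  shows "\<exists>w. (\<exists>s<n. w s \<noteq> 0) \<and> (\<forall>r<n. (\<Sum>s<n. B $$ (r, s) * w s) = l k * w r) \<and>
             (\<forall>j<k. (\<Sum>s<n. cnj (u j s) * w s) = 0)"
proof -
  define js where "js = filter (\<lambda>j. l j = l k) [0..<n]"
  have set_js: "set js = {j. j < n \<and> l j = l k}" by (auto simp: js_def)
  have "length js = card (set js)" by (rule distinct_card[symmetric]) (simp add: js_def)
  also have "\<dots> = count (eigenvalues_mset B) (l k)"
    unfolding eig set_js count_image_mset by (auto intro!: arg_cong[of _ _ card])
  finally have len: "length js = count (eigenvalues_mset B) (l k)" .
  obtain P Q where P: "P \<in> carrier_mat n n" and Q: "Q \<in> carrier_mat n n" and QP: "Q * P = 1\<^sub>m n"
    and m: "length js \<le> n" and eigP: "\<And>i r. i < length js \<Longrightarrow> r < n \<Longrightarrow>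
              (\<Sum>s<n. B $$ (r, s) * P $$ (s, i)) = l k * P $$ (r, i)"
    using hermitian_independent_eigenvectors[OF B herm real[OF k] len] by blast
  let ?m = "length js"
  \<comment> \<open>One row for each index with eigenvalue \<open>l k\<close>; the indices from \<open>k\<close> on, in particular \<open>k\<close>
    itself, impose no condition and give zero rows, which make the square system singular.\<close>
  define R where "R = (\<lambda>r i. if js ! r < k then \<Sum>s<n. cnj (u (js ! r) s) * P $$ (s, i) else 0)"
  have "k \<in> set js" using k by (simp add: set_js)
  then obtain r0 where r0: "r0 < ?m" "js ! r0 = k" by (auto simp: in_set_conv_nth)
  obtain x where x: "\<exists>i<?m. x i \<noteq> 0" "\<forall>r<?m. (\<Sum>i<?m. R r i * x i) = 0"
    using homogeneous_system_zero_row[of r0 ?m R] r0 by (auto simp: R_def)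
  define w where "w = (\<lambda>s. \<Sum>i<?m. P $$ (s, i) * x i)"
  have w_sum: "(\<Sum>s<n. c s * w s) = (\<Sum>i<?m. (\<Sum>s<n. c s * P $$ (s, i)) * x i)" for c
    unfolding w_def sum_distrib_left sum_distrib_right mult.assoc by (rule sum.swap)
  have w_eig: "(\<Sum>s<n. B $$ (r, s) * w s) = l k * w r" if "r < n" for r
    unfolding w_sum using eigP that by (simp add: w_def sum_distrib_left mult.assoc)
  have "\<exists>s<n. w s \<noteq> 0"
  proof (rule ccontr)
    assume *: "\<not> ?thesis"
    have "x i = 0" if i: "i < ?m" for i
    proof -
      have "(\<Sum>s<n. Q $$ (i, s) * P $$ (s, j)) = (if i = j then 1 else 0)" if "j < ?m" for j
      proof -
        have "(Q * P) $$ (i, j) = (\<Sum>s<n. Q $$ (i, s) * P $$ (s, j))"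
          using i that m P Q by (simp add: scalar_prod_def atLeast0LessThan)
        then show ?thesis using QP i that m by simp
      qed
      then have "(\<Sum>s<n. Q $$ (i, s) * w s) = (\<Sum>j<?m. (if i = j then 1 else 0) * x j)"
        unfolding w_sum by (intro sum.cong) auto
      also have "\<dots> = x i" using i by (simp add: if_distrib[of "\<lambda>a. a * _"] sum.delta cong: if_cong)
      finally show ?thesis using * by simp
    qed
    with x(1) show False by blast
  qed
  moreover have "(\<Sum>s<n. cnj (u j s) * w s) = 0" if j: "j < k" for j
  proof (cases "l j = l k")
    case True
    then have "j \<in> set js" using j k by (simp add: set_js)
    then obtain r where r: "r < ?m" "js ! r = j" by (auto simp: in_set_conv_nth)
    then show ?thesis
      unfolding w_sum using x(2) j by (auto simp: R_def)
  next
    case False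
    show ?thesis
      by (rule hermitian_eigenvectors_orthogonal[of n "\<lambda>r s. B $$ (r, s)" "l j" "l k", OF herm])
        (use real[of j] j k False u w_eig in auto)
  qed
  ultimately show ?thesis using w_eig by blast
qed

section \<open>The ring of functions holomorphic on the circle\<close>

lemma hol_circle_cong:
  assumes "f \<in> hol_circle" "\<And>z. z \<in> unit_circle \<Longrightarrow> f z = g z"
  shows "g \<in> hol_circle"
  using assms unfolding hol_circle_def by auto

lemma hol_circle_const: "(\<lambda>z. c) \<in> hol_circle"
  unfolding hol_circle_iff_analytic by (intro exI[of _ "\<lambda>z. c"]) auto

lemma hol_circle_add:
  assumes "f \<in> hol_circle" "g \<in> hol_circle"
  shows "(\<lambda>z. f z + g z) \<in> hol_circle"
proof -
  obtain f' g' where "f' analytic_on unit_circle" "\<forall>z\<in>unit_circle. f' z = f z"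
      "g' analytic_on unit_circle" "\<forall>z\<in>unit_circle. g' z = g z"
    using assms unfolding hol_circle_iff_analytic by blast
  then show ?thesis
    unfolding hol_circle_iff_analytic
    by (intro exI[of _ "\<lambda>z. f' z + g' z"]) (auto intro: analytic_intros)
qed

lemma hol_circle_mult:
  assumes "f \<in> hol_circle" "g \<in> hol_circle"
  shows "(\<lambda>z. f z * g z) \<in> hol_circle"
proof -
  obtain f' g' where "f' analytic_on unit_circle" "\<forall>z\<in>unit_circle. f' z = f z"
      "g' analytic_on unit_circle" "\<forall>z\<in>unit_circle. g' z = g z"
    using assms unfolding hol_circle_iff_analytic by blast
  then show ?thesis
    unfolding hol_circle_iff_analytic
    by (intro exI[of _ "\<lambda>z. f' z * g' z"]) (auto intro: analytic_intros)
qed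

lemma hol_circle_minus: "f \<in> hol_circle \<Longrightarrow> (\<lambda>z. - f z) \<in> hol_circle"
  using hol_circle_mult[OF hol_circle_const[of "-1"], of f] by simp

lemma hol_circle_diff:
  assumes "f \<in> hol_circle" "g \<in> hol_circle"
  shows "(\<lambda>z. f z - g z) \<in> hol_circle"
  using hol_circle_add[OF assms(1) hol_circle_minus[OF assms(2)]] by simp

lemma hol_circle_sum:
  "(\<And>i. i \<in> I \<Longrightarrow> f i \<in> hol_circle) \<Longrightarrow> (\<lambda>z. \<Sum>i\<in>I. f i z) \<in> hol_circle"
  by (induction I rule: infinite_finite_induct) (auto intro: hol_circle_const hol_circle_add)

text \<open>On the circle \<open>z\<close> and \<open>1 / cnj z\<close> agree, so that the pointwise conjugate, although in
  general not holomorphic, has the para-Hermitian conjugate as a holomorphic representative.\<close>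

lemma hol_circle_cnj: "f \<in> hol_circle \<Longrightarrow> (\<lambda>z. cnj (f z)) \<in> hol_circle"
  by (rule hol_circle_cong[OF hol_circle_conj]) (simp_all add: inverse_cnj_unit_circle)

lemmas hol_circle_intros = hol_circle_const hol_circle_add hol_circle_mult hol_circle_minus
  hol_circle_diff hol_circle_sum hol_circle_cnj

lemma hol_circle_inverse_sqrt:
  assumes "f \<in> hol_circle" "\<And>z. z \<in> unit_circle \<Longrightarrow> f z \<notin> \<real>\<^sub>\<le>\<^sub>0"
  shows "(\<lambda>z. inverse (csqrt (f z))) \<in> hol_circle"
proof -
  obtain f' where f': "f' analytic_on unit_circle" "\<forall>z\<in>unit_circle. f' z = f z"
    using assms unfolding hol_circle_iff_analytic by blast
  have "csqrt (f' z) \<noteq> 0" if "z \<in> unit_circle" for z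
    using f'(2) assms(2)[OF that] that by auto
  then have "(\<lambda>z. inverse (csqrt (f' z))) analytic_on unit_circle"
    using f' assms(2) by (intro analytic_intros) auto
  with f'(2) show ?thesis
    unfolding hol_circle_iff_analytic by (intro exI[of _ "\<lambda>z. inverse (csqrt (f' z))"]) auto
qed

lemma connected_unit_circle: "connected unit_circle"
  by (intro connected_sphere) simp

lemma infinite_unit_circle: "infinite unit_circle"
proof
  assume "finite unit_circle"
  then obtain x where "unit_circle \<subseteq> {x}"
    using connected_finite_iff_sing[OF connected_unit_circle] by auto
  moreover have "1 \<in> unit_circle" "-1 \<in> unit_circle" by simp_all
  ultimately have "(1::complex) = -1" by blast
  then show False by simp
qed

text \<open>The circle is connected, hence so is a suitable neighbourhood of it to which the function
  extends; only there is the identity theorem applicable.\<close>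

lemma hol_circle_connected_extension:
  assumes "f \<in> hol_circle"
  obtains S g where "open S" "connected S" "unit_circle \<subseteq> S" "g holomorphic_on S"
    "\<And>z. z \<in> unit_circle \<Longrightarrow> g z = f z"
proof -
  obtain T g where T: "open T" "unit_circle \<subseteq> T" "g holomorphic_on T"
      "\<forall>z\<in>unit_circle. g z = f z"
    using assms by (auto simp: hol_circle_def)
  let ?S = "connected_component_set T 1"
  have "unit_circle \<subseteq> ?S"
    using T(2) connected_unit_circle by (intro connected_component_maximal) auto
  moreover have "g holomorphic_on ?S"
    using T(3) connected_component_subset holomorphic_on_subset by blast
  ultimately show ?thesis
    using that[of ?S g] open_connected_component[OF T(1)] T(4) by auto
qed

lemma hol_circle_finite_zeros:
  assumes "f \<in> hol_circle" "z1 \<in> unit_circle" "f z1 \<noteq> 0"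
  shows "finite {z \<in> unit_circle. f z = 0}"
proof (rule ccontr)
  assume inf: "infinite {z \<in> unit_circle. f z = 0}"
  obtain S g where S: "open S" "connected S" "unit_circle \<subseteq> S" "g holomorphic_on S"
      "\<And>z. z \<in> unit_circle \<Longrightarrow> g z = f z"
    using hol_circle_connected_extension[OF assms(1)] by blast
  have "compact unit_circle" by simp
  then obtain x where x: "x \<in> unit_circle" "x islimpt {z \<in> unit_circle. f z = 0}"
    using inf unfolding compact_eq_Bolzano_Weierstrass by (metis (no_types, lifting) mem_Collect_eq subsetI)
  have "g z1 = 0"
    by (rule analytic_continuation[OF S(4,1,2) _ _ x(2)]) (use S x(1) assms(2) in auto)
  with S(5) assms(2,3) show False by simp
qed

lemma hol_circle_mult_nonzero:
  assumes "f \<in> hol_circle" "z1 \<in> unit_circle" "f z1 \<noteq> 0"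
    and "g \<in> hol_circle" "z2 \<in> unit_circle" "g z2 \<noteq> 0"
  shows "\<exists>z\<in>unit_circle. f z * g z \<noteq> 0"
proof (rule ccontr)
  assume "\<not> ?thesis"
  then have "unit_circle \<subseteq> {z \<in> unit_circle. f z = 0} \<union> {z \<in> unit_circle. g z = 0}"
    by auto
  with hol_circle_finite_zeros[OF assms(1-3)] hol_circle_finite_zeros[OF assms(4-6)]
    infinite_unit_circle show False
    by (meson finite_Un finite_subset)
qed

lemma hol_circle_eq_0:
  assumes "f \<in> hol_circle" "finite E" "\<And>z. z \<in> unit_circle - E \<Longrightarrow> f z = 0" "z \<in> unit_circle"
  shows "f z = 0"
proof (rule ccontr)
  assume "f z \<noteq> 0"
  then have "finite {z \<in> unit_circle. f z = 0}"
    using hol_circle_finite_zeros assms by blast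
  moreover have "unit_circle \<subseteq> {z \<in> unit_circle. f z = 0} \<union> E"
    using assms(3) by blast
  ultimately show False
    using infinite_unit_circle assms(2) by (meson finite_Un finite_subset)
qed

section \<open>Dividing out common zeros\<close>

lemma hol_circle_divide_zero:
  assumes "f \<in> hol_circle" "z0 \<in> unit_circle" "f z0 = 0"
  obtains q where "q \<in> hol_circle" "\<And>z. z \<in> unit_circle \<Longrightarrow> f z = (z - z0) * q z"
proof -
  obtain T g where T: "open T" "unit_circle \<subseteq> T" "g holomorphic_on T"
      "\<forall>z\<in>unit_circle. g z = f z"
    using assms by (auto simp: hol_circle_def)
  let ?q = "\<lambda>z. if z = z0 then deriv g z0 else (g z - g z0) / (z - z0)"
  have "?q holomorphic_on T"
    using pole_lemma_open[OF T(3,1)] .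
  then have "?q \<in> hol_circle"
    unfolding hol_circle_def using T(1,2) by blast
  moreover have "f z = (z - z0) * ?q z" if "z \<in> unit_circle" for z
    using that T(4) assms(2,3) by auto
  ultimately show ?thesis using that by blast
qed

lemma hol_circle_order:
  assumes "f \<in> hol_circle" "z1 \<in> unit_circle" "f z1 \<noteq> 0" "z0 \<in> unit_circle"
  obtains k q where "q \<in> hol_circle" "q z0 \<noteq> 0"
    "\<And>z. z \<in> unit_circle \<Longrightarrow> f z = (z - z0) ^ k * q z"
proof (cases "f z0 = 0")
  case False
  then show ?thesis using that[of f 0] assms(1) by simp
next
  case True
  obtain S g where S: "open S" "connected S" "unit_circle \<subseteq> S" "g holomorphic_on S"
      "\<And>z. z \<in> unit_circle \<Longrightarrow> g z = f z"
    using hol_circle_connected_extension[OF assms(1)] by blast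
  have "\<not> g constant_on S"
    using S(3,5) True assms(2,3,4) unfolding constant_on_def by (metis subsetD)
  then obtain h r k where h: "0 < k" "0 < r" "ball z0 r \<subseteq> S" "h holomorphic_on ball z0 r"
      "\<And>w. w \<in> ball z0 r \<Longrightarrow> g w = (w - z0) ^ k * h w" "\<And>w. w \<in> ball z0 r \<Longrightarrow> h w \<noteq> 0"
    using holomorphic_factor_zero_nonconstant[OF S(4,1,2), of z0] S(3,5) True assms(4)
    by (metis subsetD)
  \<comment> \<open>The cofactor given by the local factorization is glued with the global quotient.\<close>
  define q where "q = (\<lambda>z. if z = z0 then h z0 else g z / (z - z0) ^ k)"
  have "q z = h z" if "z \<in> ball z0 r" for z
    using h(5)[OF that] by (auto simp: q_def)
  then have "q holomorphic_on ball z0 r"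
    using h(4) holomorphic_cong by blast
  moreover have "q holomorphic_on S - {z0}"
  proof -
    have "(\<lambda>z. g z / (z - z0) ^ k) holomorphic_on S - {z0}"
      by (intro holomorphic_intros holomorphic_on_subset[OF S(4)]) auto
    then show ?thesis
      by (rule holomorphic_transform) (auto simp: q_def)
  qed
  ultimately have "q holomorphic_on (ball z0 r \<union> (S - {z0}))"
    using S(1) by (intro holomorphic_on_Un) auto
  then have "q \<in> hol_circle"
    unfolding hol_circle_def mem_Collect_eq
    by (intro exI[of _ "ball z0 r \<union> (S - {z0})"] exI[of _ q]) (use S(1,3) h(2) in auto)
  moreover have "q z0 \<noteq> 0" using h(2,6) by (simp add: q_def)
  moreover have "f z = (z - z0) ^ k * q z" if "z \<in> unit_circle" for z
    using S(5)[OF that] S(5)[OF assms(4)] True h(1) by (auto simp: q_def)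
  ultimately show ?thesis using that by blast
qed

text \<open>Induction on the order of \<open>v j0\<close> at \<open>z0\<close>: as long as all entries vanish at \<open>z0\<close>, a factor
  \<open>z - z0\<close> can be taken out of each of them, which lowers this order.\<close>

lemma divide_common_zero_at:
  fixes v :: "nat \<Rightarrow> complex \<Rightarrow> complex"
  assumes "\<And>j. j < n \<Longrightarrow> v j \<in> hol_circle" "z0 \<in> unit_circle"
    and "j0 < n" "z1 \<in> unit_circle" "v j0 z1 \<noteq> 0"
  shows "\<exists>d w. (\<forall>j<n. w j \<in> hol_circle \<and> (\<forall>z\<in>unit_circle. v j z = (z - z0) ^ d * w j z)) \<and>
               (\<exists>j<n. w j z0 \<noteq> 0)"
proof -
  obtain k q where "q z0 \<noteq> 0" "\<And>z. z \<in> unit_circle \<Longrightarrow> v j0 z = (z - z0) ^ k * q z"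
      "q \<in> hol_circle"
    using hol_circle_order assms by metis
  with assms(1) show ?thesis
  proof (induction k arbitrary: v)
    case 0
    then show ?case
      using assms(2,3) by (intro exI[of _ 0] exI[of _ v]) auto
  next
    case (Suc k)
    show ?case
    proof (cases "\<exists>j<n. v j z0 \<noteq> 0")
      case True
      then show ?thesis
        using Suc.prems by (intro exI[of _ 0] exI[of _ v]) auto
    next
      case False
      then have "\<forall>j. \<exists>p. j < n \<longrightarrow> p \<in> hol_circle \<and> (\<forall>z\<in>unit_circle. v j z = (z - z0) * p z)"
        using Suc.prems(1) assms(2) hol_circle_divide_zero by metis
      then obtain p where p: "\<And>j. j < n \<Longrightarrow> p j \<in> hol_circle"
          "\<And>j z. j < n \<Longrightarrow> z \<in> unit_circle \<Longrightarrow> v j z = (z - z0) * p j z"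
        by metis
      have "(\<lambda>z. p j0 z - (z - z0) ^ k * q z) \<in> hol_circle"
      proof -
        have "(\<lambda>z. (z - z0) ^ k) \<in> hol_circle"
          unfolding hol_circle_iff_analytic
          by (intro exI[of _ "\<lambda>z. (z - z0) ^ k"]) (auto intro!: analytic_intros)
        then show ?thesis using p(1) assms(3) Suc.prems(4) by (intro hol_circle_intros)
      qed
      moreover have "p j0 z - (z - z0) ^ k * q z = 0" if "z \<in> unit_circle - {z0}" for z
        using that p(2)[OF assms(3), of z] Suc.prems(3)[of z] by auto
      ultimately have "p j0 z = (z - z0) ^ k * q z" if "z \<in> unit_circle" for z
        using hol_circle_eq_0[of "\<lambda>z. p j0 z - (z - z0) ^ k * q z" "{z0}" z] that by auto
      from Suc.IH[of p, OF p(1) Suc.prems(2) this Suc.prems(4)] obtain d w where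
        "\<forall>j<n. w j \<in> hol_circle \<and> (\<forall>z\<in>unit_circle. p j z = (z - z0) ^ d * w j z)"
        "\<exists>j<n. w j z0 \<noteq> 0"
        by blast
      with p(2) show ?thesis
        by (intro exI[of _ "Suc d"] exI[of _ w]) auto
    qed
  qed
qed

text \<open>Among the common zeros, which are finitely many, \<open>divide_common_zero_at\<close> removes one without
  creating a new one; the product of the divisors is \<open>h\<close>.\<close>

lemma divide_common_zeros:
  fixes v :: "nat \<Rightarrow> complex \<Rightarrow> complex"
  assumes "\<And>j. j < n \<Longrightarrow> v j \<in> hol_circle"
    and "j0 < n" "z1 \<in> unit_circle" "v j0 z1 \<noteq> 0"
  shows "\<exists>h w. (\<forall>j<n. w j \<in> hol_circle) \<and> finite {z \<in> unit_circle. h z = 0} \<and>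
               (\<forall>j<n. \<forall>z\<in>unit_circle. v j z = h z * w j z) \<and>
               (\<forall>z\<in>unit_circle. \<exists>j<n. w j z \<noteq> 0)"
proof -
  define Z where "Z = {z \<in> unit_circle. \<forall>j<n. v j z = 0}"
  have "finite Z"
    using finite_subset[OF _ hol_circle_finite_zeros[OF assms(1)[OF assms(2)] assms(3,4)], of Z]
      assms(2) by (auto simp: Z_def)
  moreover have "\<forall>j<n. v j \<in> hol_circle" "\<exists>j<n. \<exists>z\<in>unit_circle. v j z \<noteq> 0"
    using assms by blast+
  ultimately show ?thesis using Z_def
  proof (induction Z arbitrary: v rule: finite_induct)
    case empty
    then have "\<forall>z\<in>unit_circle. \<exists>j<n. v j z \<noteq> 0" by blast
    with empty.prems show ?case
      by (intro exI[of _ "\<lambda>z. 1"] exI[of _ v]) auto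
  next
    case (insert z0 Z)
    have z0: "z0 \<in> unit_circle" using insert.prems(3) by blast
    obtain d w where w: "\<And>j. j < n \<Longrightarrow> w j \<in> hol_circle"
        "\<And>j z. j < n \<Longrightarrow> z \<in> unit_circle \<Longrightarrow> v j z = (z - z0) ^ d * w j z"
        "\<exists>j<n. w j z0 \<noteq> 0"
      using divide_common_zero_at[of n v z0] insert.prems(1,2) z0 by metis
    have "Z = {z \<in> unit_circle. \<forall>j<n. w j z = 0}"
    proof (intro equalityI subsetI)
      fix z assume z: "z \<in> Z"
      then have "z \<noteq> z0" "z \<in> unit_circle" "\<forall>j<n. v j z = 0"
        using insert.hyps(2) insert.prems(3) by auto
      then show "z \<in> {z \<in> unit_circle. \<forall>j<n. w j z = 0}" using w(2) by simp
    next
      fix z assume z: "z \<in> {z \<in> unit_circle. \<forall>j<n. w j z = 0}"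
      then have "z \<noteq> z0" using w(3) by auto
      moreover have "z \<in> insert z0 Z" unfolding insert.prems(3) using z w(2) by auto
      ultimately show "z \<in> Z" by simp
    qed
    then obtain h w' where w': "\<forall>j<n. w' j \<in> hol_circle" "finite {z \<in> unit_circle. h z = 0}"
        "\<forall>j<n. \<forall>z\<in>unit_circle. w j z = h z * w' j z" "\<forall>z\<in>unit_circle. \<exists>j<n. w' j z \<noteq> 0"
      using insert.IH[of w] w(1,3) z0 by blast
    have "{z \<in> unit_circle. (z - z0) ^ d * h z = 0} \<subseteq> insert z0 {z \<in> unit_circle. h z = 0}"
      by auto
    then have "finite {z \<in> unit_circle. (z - z0) ^ d * h z = 0}"
      using w'(2) by (meson finite.insertI finite_subset)
    moreover have "\<forall>j<n. \<forall>z\<in>unit_circle. v j z = (z - z0) ^ d * h z * w' j z"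
      using w'(3) w(2) by (simp add: mult.assoc)
    ultimately show ?case
      using w'(1,4) by (intro exI[of _ "\<lambda>z. (z - z0) ^ d * h z"] exI[of _ w']) simp
  qed
qed

section \<open>Linear systems over the ring\<close>

text \<open>Gaussian elimination of the last unknown, without divisions so as to stay in the ring. At a
  zero of the pivot the reduced system may lose its nontrivial solution; this is why solvability is
  required only outside a finite set \<open>E\<close>, to which the zeros of the pivot are added. The equations
  may be indexed by any set, since just one of them is used as pivot row for each unknown.\<close>

lemma hol_circle_kernel_vector:
  fixes a :: "'r \<Rightarrow> nat \<Rightarrow> complex \<Rightarrow> complex"
  assumes "\<And>r j. r \<in> J \<Longrightarrow> j < n \<Longrightarrow> a r j \<in> hol_circle" "finite E"
    and "\<And>z. z \<in> unit_circle - E \<Longrightarrow>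
           \<exists>w. (\<exists>j<n. w j \<noteq> 0) \<and> (\<forall>r\<in>J. (\<Sum>j<n. a r j z * w j) = 0)"
  shows "\<exists>v. (\<forall>j<n. v j \<in> hol_circle) \<and> (\<exists>j<n. \<exists>z\<in>unit_circle. v j z \<noteq> 0) \<and>
             (\<forall>z\<in>unit_circle. \<forall>r\<in>J. (\<Sum>j<n. a r j z * v j z) = 0)"
  using assms
proof (induction n arbitrary: a E)
  case 0
  obtain z where "z \<in> unit_circle - E"
    using infinite_unit_circle "0.prems"(2) by (metis finite_subset Diff_eq_empty_iff ex_in_conv)
  with "0.prems"(3) show ?case by blast
next
  case (Suc n)
  show ?case
  proof (cases "\<exists>r0\<in>J. \<exists>z\<in>unit_circle. a r0 n z \<noteq> 0")
    case False
    then show ?thesis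
      by (intro exI[of _ "\<lambda>j z. if j = n then 1 else 0"] conjI exI[of _ n] bexI[of _ 1])
        (auto intro: hol_circle_const)
  next
    case True
    then obtain r0 z0 where r0: "r0 \<in> J" "z0 \<in> unit_circle" "a r0 n z0 \<noteq> 0" by blast
    define p where "p = a r0 n"
    have p: "p \<in> hol_circle" using Suc.prems(1) r0 by (simp add: p_def)
    define b where "b = (\<lambda>r j z. p z * a r j z - a r n z * a r0 j z)"
    have b_sum: "(\<Sum>j<n. b r j z * x j) = p z * (\<Sum>j<n. a r j z * x j) - a r n z * (\<Sum>j<n. a r0 j z * x j)"
      for r z and x :: "nat \<Rightarrow> complex"
      by (simp add: b_def sum_distrib_left sum_subtractf left_diff_distrib mult.assoc)
    let ?E = "E \<union> {z \<in> unit_circle. p z = 0}"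
    have "\<exists>w. (\<exists>j<n. w j \<noteq> 0) \<and> (\<forall>r\<in>J. (\<Sum>j<n. b r j z * w j) = 0)"
      if z: "z \<in> unit_circle - ?E" for z
    proof -
      obtain w where w: "\<exists>j<Suc n. w j \<noteq> 0" "\<And>r. r \<in> J \<Longrightarrow> (\<Sum>j<Suc n. a r j z * w j) = 0"
        using Suc.prems(3)[of z] z by auto
      have s: "(\<Sum>j<n. a r j z * w j) = - (a r n z * w n)" if "r \<in> J" for r
        using w(2)[OF that] by (simp add: eq_neg_iff_add_eq_0)
      have "\<exists>j<n. w j \<noteq> 0"
      proof (rule ccontr)
        assume *: "\<not> ?thesis"
        then have "p z * w n = 0" using s[OF r0(1)] by (simp add: p_def)
        then have "w n = 0" using z by auto
        with * w(1) show False by (auto simp: less_Suc_eq)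
      qed
      moreover have "(\<Sum>j<n. b r j z * w j) = 0" if "r \<in> J" for r
        unfolding b_sum s[OF that] s[OF r0(1)] by (simp add: p_def)
      ultimately show ?thesis by blast
    qed
    moreover have "finite ?E"
      using Suc.prems(2) hol_circle_finite_zeros[OF p r0(2)] r0(3) by (simp add: p_def)
    moreover have "b r j \<in> hol_circle" if "r \<in> J" "j < n" for r j
      using Suc.prems(1) that p r0(1) unfolding b_def by (intro hol_circle_diff hol_circle_mult) auto
    ultimately obtain v where v: "\<And>j. j < n \<Longrightarrow> v j \<in> hol_circle"
        "\<exists>j<n. \<exists>z\<in>unit_circle. v j z \<noteq> 0"
        "\<And>z r. z \<in> unit_circle \<Longrightarrow> r \<in> J \<Longrightarrow> (\<Sum>j<n. b r j z * v j z) = 0"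
      using Suc.IH[of b ?E] by blast
    define u where "u = (\<lambda>j z. if j = n then - (\<Sum>j<n. a r0 j z * v j z) else p z * v j z)"
    have u_less: "u j = (\<lambda>z. p z * v j z)" if "j < n" for j using that by (simp add: u_def)
    have "u n = (\<lambda>z. - (\<Sum>j<n. a r0 j z * v j z))" by (simp add: u_def)
    then have "u j \<in> hol_circle" if "j < Suc n" for j
      using that v(1) p Suc.prems(1)[OF r0(1)] u_less
      by (cases "j = n") (auto intro!: hol_circle_minus hol_circle_sum hol_circle_mult)
    moreover have "\<exists>j<Suc n. \<exists>z\<in>unit_circle. u j z \<noteq> 0"
    proof -
      obtain j z where j: "j < n" "z \<in> unit_circle" "v j z \<noteq> 0" using v(2) by blast
      then obtain z' where "z' \<in> unit_circle" "p z' * v j z' \<noteq> 0"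
        using hol_circle_mult_nonzero[OF p r0(2) _ v(1)[OF j(1)] j(2,3)] r0(3) by (auto simp: p_def)
      then show ?thesis using u_less j(1) by (intro exI[of _ j]) auto
    qed
    moreover have "(\<Sum>j<Suc n. a r j z * u j z) = 0" if "z \<in> unit_circle" "r \<in> J" for z r
    proof -
      have "(\<Sum>j<n. a r j z * u j z) = p z * (\<Sum>j<n. a r j z * v j z)"
        unfolding sum_distrib_left by (intro sum.cong) (auto simp: u_def)
      then show ?thesis
        using v(3)[OF that] unfolding b_sum by (simp add: u_def)
    qed
    ultimately show ?thesis by blast
  qed
qed

text \<open>The zeros of a solution are divided out and it is scaled to norm one. The quotient solves
  the system also at the zeros of the divisor \<open>h\<close>, because a function holomorphic on the circle
  that vanishes outside a finite set vanishes identically.\<close>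

lemma hol_circle_unit_kernel_vector:
  fixes a :: "'r \<Rightarrow> nat \<Rightarrow> complex \<Rightarrow> complex"
  assumes a: "\<And>r j. r \<in> J \<Longrightarrow> j < n \<Longrightarrow> a r j \<in> hol_circle"
    and ker: "\<And>z. z \<in> unit_circle \<Longrightarrow>
           \<exists>w. (\<exists>j<n. w j \<noteq> 0) \<and> (\<forall>r\<in>J. (\<Sum>j<n. a r j z * w j) = 0)"
  shows "\<exists>v. (\<forall>j<n. v j \<in> hol_circle) \<and>
             (\<forall>z\<in>unit_circle. (\<Sum>j<n. cnj (v j z) * v j z) = 1) \<and>
             (\<forall>z\<in>unit_circle. \<forall>r\<in>J. (\<Sum>j<n. a r j z * v j z) = 0)"
proof -
  obtain v where v: "\<forall>j<n. v j \<in> hol_circle" "\<exists>j<n. \<exists>z\<in>unit_circle. v j z \<noteq> 0"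
      "\<forall>z\<in>unit_circle. \<forall>r\<in>J. (\<Sum>j<n. a r j z * v j z) = 0"
    using hol_circle_kernel_vector[of J n a "{}"] assms by auto
  then obtain j0 z1 where "j0 < n" "z1 \<in> unit_circle" "v j0 z1 \<noteq> 0" by blast
  from divide_common_zeros[of n v, OF _ this] v(1)
  obtain h w where w: "\<And>j. j < n \<Longrightarrow> w j \<in> hol_circle" "finite {z \<in> unit_circle. h z = 0}"
      "\<And>j z. j < n \<Longrightarrow> z \<in> unit_circle \<Longrightarrow> v j z = h z * w j z"
      "\<And>z. z \<in> unit_circle \<Longrightarrow> \<exists>j<n. w j z \<noteq> 0"
    by blast
  have w_ker: "(\<Sum>j<n. a r j z * w j z) = 0" if "z \<in> unit_circle" "r \<in> J" for z r
  proof (rule hol_circle_eq_0[of "\<lambda>z. \<Sum>j<n. a r j z * w j z" _ z, OF _ w(2) _ that(1)])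
    show "(\<lambda>z. \<Sum>j<n. a r j z * w j z) \<in> hol_circle"
      using a w(1) that by (intro hol_circle_sum hol_circle_mult) auto
    fix x :: complex assume x: "x \<in> unit_circle - {z \<in> unit_circle. h z = 0}"
    have "0 = (\<Sum>j<n. a r j x * v j x)" using v(3) x that by simp
    also have "\<dots> = h x * (\<Sum>j<n. a r j x * w j x)"
      unfolding sum_distrib_left using w(3) x by (intro sum.cong) auto
    finally show "(\<Sum>j<n. a r j x * w j x) = 0" using x by auto
  qed
  define s where "s = (\<lambda>z. \<Sum>j<n. cnj (w j z) * w j z)"
  define t where "t = (\<lambda>z. \<Sum>j<n. (cmod (w j z))\<^sup>2)"
  have s_t: "s z = of_real (t z)" for z
    unfolding s_def t_def by (rule sum_cnj_mult_self)
  have t_pos: "t z > 0" if z: "z \<in> unit_circle" for z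
  proof -
    obtain j where "j < n" "w j z \<noteq> 0" using w(4)[OF z] by blast
    then show ?thesis unfolding t_def by (intro sum_pos2[of _ j]) auto
  qed
  have "s \<in> hol_circle"
    unfolding s_def using w(1) by (intro hol_circle_sum hol_circle_mult hol_circle_cnj) auto
  then have c: "(\<lambda>z. inverse (csqrt (s z))) \<in> hol_circle"
    by (rule hol_circle_inverse_sqrt) (use t_pos in \<open>auto simp: s_t not_le\<close>)
  have sq: "csqrt (s z) = of_real (sqrt (t z))" if "z \<in> unit_circle" for z
    unfolding s_t using t_pos[OF that] by (simp add: csqrt_of_real_nonneg)
  define u where "u = (\<lambda>j z. inverse (csqrt (s z)) * w j z)"
  have "u j \<in> hol_circle" if "j < n" for j
    unfolding u_def using c w(1)[OF that] by (rule hol_circle_mult)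
  moreover have "(\<Sum>j<n. cnj (u j z) * u j z) = 1" if "z \<in> unit_circle" for z
  proof -
    have "(\<Sum>j<n. cnj (u j z) * u j z) = (inverse (of_real (sqrt (t z))))\<^sup>2 * s z"
      unfolding u_def sq[OF that] unfolding s_def sum_distrib_left
      by (intro sum.cong) (simp_all add: power2_eq_square)
    also have "\<dots> = of_real ((inverse (sqrt (t z)))\<^sup>2 * t z)"
      by (simp add: s_t)
    also have "\<dots> = 1"
      using t_pos[OF that] by (simp add: power_inverse)
    finally show ?thesis .
  qed
  moreover have "(\<Sum>j<n. a r j z * u j z) = 0" if "z \<in> unit_circle" "r \<in> J" for z r
  proof -
    have "(\<Sum>j<n. a r j z * u j z) = inverse (csqrt (s z)) * (\<Sum>j<n. a r j z * w j z)"
      unfolding sum_distrib_left u_def by (intro sum.cong) auto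
    then show ?thesis using w_ker[OF that] by simp
  qed
  ultimately show ?thesis by blast
qed

section \<open>Orthonormal eigenvectors holomorphic on the circle\<close>

lemma para_hermitian_entry:
  assumes "para_hermitian n A" "z \<in> unit_circle" "r < n" "s < n"
  shows "A z $$ (r, s) = cnj (A z $$ (s, r))"
proof -
  have "A z = para_conj A z" "A \<in> hol_circle_mat n n"
    using assms by (auto simp: para_hermitian_def)
  then have "A z $$ (r, s) = Matrix.mat n n (\<lambda>(i, j). cnj (A z $$ (j, i))) $$ (r, s)"
    using para_conj_unit_circle[of A n n z] assms(2) by metis
  then show ?thesis using assms(3,4) by simp
qed

text \<open>The equations \<open>(A - l k) v = 0\<close> and \<open>u j\<^sup>* v = 0\<close> form one linear system, with rows indexed by
  a sum type: \<open>Inl r\<close> for the rows of \<open>A - l k\<close> and \<open>Inr j\<close> for the orthogonality conditions.\<close>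

lemma next_hol_eigenvector:
  assumes A: "para_hermitian n A"
    and l: "\<And>i. i < n \<Longrightarrow> l i \<in> hol_circle"
    and real: "\<And>z i. z \<in> unit_circle \<Longrightarrow> i < n \<Longrightarrow> l i z \<in> \<real>"
    and eig: "\<And>z. z \<in> unit_circle \<Longrightarrow> eigenvalues_mset (A z) = image_mset (\<lambda>i. l i z) (mset_set {..<n})"
    and k: "k < n"
    and u: "\<And>j s. j < k \<Longrightarrow> s < n \<Longrightarrow> u j s \<in> hol_circle"
    and u_eig: "\<And>j r z. j < k \<Longrightarrow> r < n \<Longrightarrow> z \<in> unit_circle \<Longrightarrow>
                  (\<Sum>s<n. A z $$ (r, s) * u j s z) = l j z * u j r z"
  shows "\<exists>v. (\<forall>s<n. v s \<in> hol_circle) \<and>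
             (\<forall>z\<in>unit_circle. (\<Sum>s<n. cnj (v s z) * v s z) = 1) \<and>
             (\<forall>r<n. \<forall>z\<in>unit_circle. (\<Sum>s<n. A z $$ (r, s) * v s z) = l k z * v r z) \<and>
             (\<forall>j<k. \<forall>z\<in>unit_circle. (\<Sum>s<n. cnj (u j s z) * v s z) = 0)"
proof -
  have A_hol: "A \<in> hol_circle_mat n n" using A by (simp add: para_hermitian_def)
  define J where "J = Inl ` {..<n} \<union> Inr ` {..<k}"
  define a where "a = case_sum (\<lambda>r s z. A z $$ (r, s) - (if r = s then l k z else 0)) (\<lambda>j s z. cnj (u j s z))"
  have a_hol: "a i s \<in> hol_circle" if i: "i \<in> J" and s: "s < n" for i s
  proof (cases i)
    case (Inl r)
    then have "r < n" using i by (auto simp: J_def)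
    then have "(\<lambda>z. A z $$ (r, s)) \<in> hol_circle"
      using A_hol s by (auto simp: hol_circle_mat_def)
    moreover have "(\<lambda>z. if r = s then l k z else 0) \<in> hol_circle"
      using l[OF k] hol_circle_const by (cases "r = s") auto
    ultimately show ?thesis unfolding a_def Inl sum.case by (rule hol_circle_diff)
  next
    case (Inr j)
    then have "j < k" using i by (auto simp: J_def)
    then show ?thesis unfolding a_def Inr sum.case using u s by (intro hol_circle_cnj)
  qed
  have a_Inl: "(\<Sum>s<n. a (Inl r) s z * x s) = (\<Sum>s<n. A z $$ (r, s) * x s) - l k z * x r" if "r < n" for r z x
  proof -
    have "(\<Sum>s<n. a (Inl r) s z * x s) = (\<Sum>s<n. A z $$ (r, s) * x s - (if s = r then l k z * x s else 0))"
      by (intro sum.cong) (auto simp: a_def left_diff_distrib)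
    also have "\<dots> = (\<Sum>s<n. A z $$ (r, s) * x s) - l k z * x r"
      using that by (simp add: sum_subtractf)
    finally show ?thesis .
  qed
  have a_Inr: "(\<Sum>s<n. a (Inr j) s z * x s) = (\<Sum>s<n. cnj (u j s z) * x s)" for j z x
    by (simp add: a_def)
  have "\<exists>w. (\<exists>s<n. w s \<noteq> 0) \<and> (\<forall>i\<in>J. (\<Sum>s<n. a i s z * w s) = 0)" if z: "z \<in> unit_circle" for z
  proof -
    have "A z \<in> carrier_mat n n" using A_hol z by (auto simp: hol_circle_mat_def)
    from hermitian_orthogonal_eigenvector[where l = "\<lambda>i. l i z" and u = "\<lambda>j s. u j s z",
        OF this para_hermitian_entry[OF A z] eig[OF z] real[OF z] k u_eig[OF _ _ z]]
    obtain w where "\<exists>s<n. w s \<noteq> 0" "\<forall>r<n. (\<Sum>s<n. A z $$ (r, s) * w s) = l k z * w r"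
        "\<forall>j<k. (\<Sum>s<n. cnj (u j s z) * w s) = 0"
      by blast
    then show ?thesis
      by (intro exI[of _ w]) (auto simp: J_def a_Inl a_Inr)
  qed
  from hol_circle_unit_kernel_vector[of J n a, OF a_hol this]
  obtain v where v: "\<forall>s<n. v s \<in> hol_circle" "\<forall>z\<in>unit_circle. (\<Sum>s<n. cnj (v s z) * v s z) = 1"
      "\<forall>z\<in>unit_circle. \<forall>i\<in>J. (\<Sum>s<n. a i s z * v s z) = 0"
    by blast
  have "(\<Sum>s<n. A z $$ (r, s) * v s z) = l k z * v r z" if "r < n" "z \<in> unit_circle" for r z
  proof -
    have "(\<Sum>s<n. a (Inl r) s z * v s z) = 0"
      using v(3) that by (auto simp: J_def)
    then show ?thesis using that by (simp add: a_Inl)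
  qed
  moreover have "(\<Sum>s<n. cnj (u j s z) * v s z) = 0" if "j < k" "z \<in> unit_circle" for j z
  proof -
    have "(\<Sum>s<n. a (Inr j) s z * v s z) = 0"
      using v(3) that by (auto simp: J_def)
    then show ?thesis by (simp add: a_Inr)
  qed
  ultimately show ?thesis using v(1,2) by blast
qed

lemma hol_orthonormal_eigenvectors:
  assumes A: "para_hermitian n A"
    and l: "\<And>i. i < n \<Longrightarrow> l i \<in> hol_circle"
    and real: "\<And>z i. z \<in> unit_circle \<Longrightarrow> i < n \<Longrightarrow> l i z \<in> \<real>"
    and eig: "\<And>z. z \<in> unit_circle \<Longrightarrow> eigenvalues_mset (A z) = image_mset (\<lambda>i. l i z) (mset_set {..<n})"
    and "k \<le> n"
  shows "\<exists>u. (\<forall>j<k. \<forall>s<n. u j s \<in> hol_circle) \<and>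
             (\<forall>j<k. \<forall>r<n. \<forall>z\<in>unit_circle. (\<Sum>s<n. A z $$ (r, s) * u j s z) = l j z * u j r z) \<and>
             (\<forall>i<k. \<forall>j<k. \<forall>z\<in>unit_circle. (\<Sum>s<n. cnj (u i s z) * u j s z) = (if i = j then 1 else 0))"
  using \<open>k \<le> n\<close>
proof (induction k)
  case 0
  then show ?case by simp
next
  case (Suc k)
  have k: "k < n" using Suc.prems by simp
  from Suc.IH[OF less_imp_le[OF k]] obtain u where u_raw: "\<forall>j<k. \<forall>s<n. u j s \<in> hol_circle"
      "\<forall>j<k. \<forall>r<n. \<forall>z\<in>unit_circle. (\<Sum>s<n. A z $$ (r, s) * u j s z) = l j z * u j r z"
      "\<forall>i<k. \<forall>j<k. \<forall>z\<in>unit_circle. (\<Sum>s<n. cnj (u i s z) * u j s z) = (if i = j then 1 else 0)"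
    by (elim exE conjE)
  note u = u_raw[rule_format]
  obtain v where v_raw: "\<forall>s<n. v s \<in> hol_circle"
      "\<forall>z\<in>unit_circle. (\<Sum>s<n. cnj (v s z) * v s z) = 1"
      "\<forall>r<n. \<forall>z\<in>unit_circle. (\<Sum>s<n. A z $$ (r, s) * v s z) = l k z * v r z"
      "\<forall>j<k. \<forall>z\<in>unit_circle. (\<Sum>s<n. cnj (u j s z) * v s z) = 0"
    using next_hol_eigenvector[where l = l, OF A l real eig k u(1,2)] by blast
  note v = v_raw[rule_format]
  have v_u: "(\<Sum>s<n. cnj (v s z) * u j s z) = 0" if "j < k" "z \<in> unit_circle" for j z
  proof -
    have "(\<Sum>s<n. cnj (v s z) * u j s z) = cnj (\<Sum>s<n. cnj (u j s z) * v s z)"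
      by (simp add: mult.commute)
    then show ?thesis using v(4)[OF that] by simp
  qed
  let ?u = "u(k := v)"
  have "?u j s \<in> hol_circle" if "j < Suc k" "s < n" for j s
    using that u(1) v(1) by (cases "j = k") auto
  moreover have "(\<Sum>s<n. A z $$ (r, s) * ?u j s z) = l j z * ?u j r z"
    if "j < Suc k" "r < n" "z \<in> unit_circle" for j r z
    using that u(2)[of j r z] v(3)[of r z] by (cases "j = k") auto
  moreover have "(\<Sum>s<n. cnj (?u i s z) * ?u j s z) = (if i = j then 1 else 0)"
    if "i < Suc k" "j < Suc k" "z \<in> unit_circle" for i j z
    using that u(3)[of i j z] v(2)[of z] v(4)[of i z] v_u[of j z]
    by (cases "i = k"; cases "j = k") auto
  ultimately show ?case by blast
qed

section \<open>Diagonalization\<close>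

theorem theorem3p3:
  fixes n :: nat
    and A :: "complex \<Rightarrow> complex mat"
    and \<mu> :: "nat \<Rightarrow> complex \<Rightarrow> complex"
  assumes "n \<ge> 1"
    and "A \<in> hol_circle_mat n n"
    and "para_hermitian n A"
    and "\<forall>i<n. \<mu> i \<in> hol_circle"
    and "\<forall>z\<in>unit_circle. \<forall>i<n. \<mu> i z \<in> \<real>"
    and "\<forall>z\<in>unit_circle. eigenvalues_mset (A z) = image_mset (\<lambda>i. \<mu> i z) (mset_set {..<n})"
  shows "\<exists>U D. para_unitary n U \<and> D \<in> hol_circle_mat n n \<and>
           (\<forall>z\<in>unit_circle. diagonal_mat (D z) \<and> (\<forall>i<n. D z $$ (i, i) = \<mu> i z)) \<and>
           (\<forall>z\<in>unit_circle. A z = U z * D z * para_conj U z)"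
proof -
  obtain u where u_raw: "\<forall>j<n. \<forall>s<n. u j s \<in> hol_circle"
      "\<forall>j<n. \<forall>r<n. \<forall>z\<in>unit_circle. (\<Sum>s<n. A z $$ (r, s) * u j s z) = \<mu> j z * u j r z"
      "\<forall>i<n. \<forall>j<n. \<forall>z\<in>unit_circle. (\<Sum>s<n. cnj (u i s z) * u j s z) = (if i = j then 1 else 0)"
    by (rule exE[OF hol_orthonormal_eigenvectors[where l = \<mu>, OF assms(3) _ _ _ order_refl]])
      (use assms(4-6) in blast)+
  note u = u_raw[rule_format]
  define U where "U = (\<lambda>z. Matrix.mat n n (\<lambda>(s, j). u j s z))"
  define D where "D = (\<lambda>z. Matrix.mat n n (\<lambda>(i, j). if i = j then \<mu> i z else 0))"
  have U: "U \<in> hol_circle_mat n n"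
    using u(1) by (simp add: hol_circle_mat_def U_def)
  have "(\<lambda>z. if i = j then \<mu> i z else 0) \<in> hol_circle" if "i < n" for i j
    using assms(4) that hol_circle_const by (cases "i = j") auto
  then have D: "D \<in> hol_circle_mat n n"
    by (simp add: hol_circle_mat_def D_def)
  have carrier: "U z \<in> carrier_mat n n" "D z \<in> carrier_mat n n" for z
    by (simp_all add: U_def D_def)
  have UP: "para_conj U z = Matrix.mat n n (\<lambda>(i, j). cnj (u i j z))" if "z \<in> unit_circle" for z
    unfolding para_conj_unit_circle[OF U that] by (intro eq_matI) (auto simp: U_def)
  have unit1: "para_conj U z * U z = 1\<^sub>m n" if "z \<in> unit_circle" for z
    unfolding UP[OF that] using u(3)[OF _ _ that]
    by (intro eq_matI) (auto simp: U_def scalar_prod_def atLeast0LessThan)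
  have carrier_UP: "para_conj U z \<in> carrier_mat n n" if "z \<in> unit_circle" for z
    using UP[OF that] by simp
  have unit2: "U z * para_conj U z = 1\<^sub>m n" if "z \<in> unit_circle" for z
    using mat_mult_left_right_inverse[OF carrier_UP[OF that] carrier(1) unit1[OF that]] .
  have "A z = U z * D z * para_conj U z" if z: "z \<in> unit_circle" for z
  proof -
    have Az: "A z \<in> carrier_mat n n" using assms(2) z by (auto simp: hol_circle_mat_def)
    have "A z * U z = U z * D z"
    proof (rule eq_matI)
      fix r j assume "r < dim_row (U z * D z)" "j < dim_col (U z * D z)"
      then have rj: "r < n" "j < n" by (auto simp: U_def D_def)
      then have "(A z * U z) $$ (r, j) = \<mu> j z * u j r z"
        using Az u(2)[OF rj(2,1) z] by (simp add: U_def scalar_prod_def atLeast0LessThan)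
      moreover have "(U z * D z) $$ (r, j) = (\<Sum>i<n. u i r z * (if i = j then \<mu> i z else 0))"
        using rj by (simp add: U_def D_def scalar_prod_def atLeast0LessThan)
      moreover have "\<dots> = (\<Sum>i<n. if i = j then \<mu> i z * u i r z else 0)"
        by (intro sum.cong) auto
      ultimately show "(A z * U z) $$ (r, j) = (U z * D z) $$ (r, j)"
        using rj by simp
    qed (use Az in \<open>auto simp: U_def D_def\<close>)
    then have "U z * D z * para_conj U z = A z * U z * para_conj U z" by simp
    also have "\<dots> = A z * (U z * para_conj U z)"
      using assoc_mult_mat[OF Az carrier(1) carrier_UP[OF z]] .
    also have "\<dots> = A z" using unit2[OF z] Az by simp
    finally show ?thesis by simp
  qed
  moreover have "diagonal_mat (D z) \<and> (\<forall>i<n. D z $$ (i, i) = \<mu> i z)" for z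
    by (auto simp: diagonal_mat_def D_def)
  moreover have "para_unitary n U"
    using U unit1 unit2 by (simp add: para_unitary_def)
  ultimately show ?thesis using D by blast
qed

end
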